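(* Fix an integer $k\ge 1$. Let $\lambda$ be a $(2k+1,2k+3)$-core partition into distinct parts which has the largest size among all $(2k+1,2k+3)$-core partitions into distinct parts. Then $\lambda=\mu_{k,k}$, where $\mu_{k,k}$ is the unique partition whose $\beta$-set is $$\{2i-1+(s-1)(2k+3)\mid 1\le s\le k,\ 1\le i\le k+1-s\}\ \cup\ \{2k+2+p(2k+3)\mid 0\le p\le k-1\}.$$
   Context: A partition is a weakly decreasing finite sequence of positive integers; its size is the sum of its parts. The hook length of a box in the Young diagram is the number of boxes to its right in its row, below it in its column, plus one. The $\beta$-set $\beta(\lambda)$ of a partition $\lambda$ is the set of hook lengths of the boxes in the first column of its Young diagram; a partition is determined by its $\beta$-set: if $h_1>h_2>\dots>h_m$ are positive integers, the unique partition with $\beta$-set $\{h_1,\dots,h_m\}$ is $(h_1-(m-1),h_2-(m-2),\dots,h_{m-1}-1,h_m)$. A partition is a $t$-core if no box has hook length divisible by $t$; an $(s,t)$-core is simultaneously an $s$-core and a $t$-core. A partition into distinct parts has pairwise distinct parts. *)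

theory Defs
  imports Main
begin

definition is_partition :: "nat list \<Rightarrow> bool" where
  "is_partition la \<longleftrightarrow> sorted_wrt (\<ge>) la \<and> (\<forall>x\<in>set la. 0 < x)"

text \<open>Boxes are pairs (row, column), both indexed from 0.\<close>

definition young_diagram :: "nat list \<Rightarrow> (nat \<times> nat) set" where
  "young_diagram la = {(i, j). i < length la \<and> j < la ! i}"

definition hook_length :: "nat list \<Rightarrow> nat \<times> nat \<Rightarrow> nat" where
  "hook_length la = (\<lambda>(i, j).
     card {j'. j < j' \<and> (i, j') \<in> young_diagram la} +
     card {i'. i < i' \<and> (i', j) \<in> young_diagram la} + 1)"

definition beta_set :: "nat list \<Rightarrow> nat set" where
  "beta_set la = {hook_length la (i, 0) |i. (i, 0) \<in> young_diagram la}"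

definition is_core :: "nat \<Rightarrow> nat list \<Rightarrow> bool" where
  "is_core t la \<longleftrightarrow> (\<forall>b\<in>young_diagram la. \<not> t dvd hook_length la b)"

definition distinct_core :: "nat \<Rightarrow> nat \<Rightarrow> nat list \<Rightarrow> bool" where
  "distinct_core s t la \<longleftrightarrow>
     is_partition la \<and> distinct la \<and> is_core s la \<and> is_core t la"

definition mu_beta :: "nat \<Rightarrow> nat set" where
  "mu_beta k =
     {2*i - 1 + (s - 1) * (2*k + 3) |s i. 1 \<le> s \<and> s \<le> k \<and> 1 \<le> i \<and> i \<le> k + 1 - s}
     \<union> {2*k + 2 + p * (2*k + 3) |p. 0 \<le> p \<and> p \<le> k - 1}"

text \<open>The description is well defined by the lemma \<open>ex1_mu\<close> below.\<close>

definition mu :: "nat \<Rightarrow> nat list" where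
  "mu k = (THE la. is_partition la \<and> beta_set la = mu_beta k)"

fun beta_list :: "nat list \<Rightarrow> nat list" where
  "beta_list [] = []"
| "beta_list (x # xs) = (x + length xs) # beta_list xs"

lemma length_beta_list [simp]: "length (beta_list la) = length la"
  by (induction la) auto

lemma nth_beta_list: "i < length la \<Longrightarrow> beta_list la ! i = la ! i + (length la - 1 - i)"
  by (induction la arbitrary: i) (auto simp: nth_Cons split: nat.splits)

lemma is_partition_Cons:
  "is_partition (x # xs) \<longleftrightarrow> 0 < x \<and> (\<forall>y\<in>set xs. y \<le> x) \<and> is_partition xs"
  by (auto simp: is_partition_def)

lemma hook_length_first_column:
  assumes "is_partition la" "i < length la"
  shows "hook_length la (i, 0) = beta_list la ! i"
proof -
  have pos: "0 < la ! j" if "j < length la" for j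
    using assms that by (auto simp: is_partition_def)
  have 1: "{j'. 0 < j' \<and> (i, j') \<in> young_diagram la} = {1..<la ! i}"
    using assms by (auto simp: young_diagram_def)
  have 2: "{i'. i < i' \<and> (i', 0) \<in> young_diagram la} = {Suc i..<length la}"
    using pos by (auto simp: young_diagram_def)
  show ?thesis
    using pos[OF assms(2)] assms(2) unfolding hook_length_def prod.case 1 2
    by (simp add: nth_beta_list)
qed

lemma beta_set_eq:
  assumes "is_partition la"
  shows "beta_set la = set (beta_list la)"
proof -
  have "(i, 0) \<in> young_diagram la \<longleftrightarrow> i < length la" for i
    using assms by (auto simp: young_diagram_def is_partition_def)
  then show ?thesis
    using hook_length_first_column[OF assms]
    unfolding beta_set_def set_conv_nth length_beta_list by (intro Collect_cong) metis
qed

lemma beta_list_less: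
  assumes "is_partition la" "\<forall>y\<in>set la. y \<le> x"
  shows "\<forall>h\<in>set (beta_list la). h < x + length la"
  using assms
proof (induction la)
  case (Cons y ys)
  then have "\<forall>h\<in>set (beta_list ys). h < x + length ys" by (simp add: is_partition_Cons)
  then show ?case using Cons.prems by auto
qed simp

lemma beta_list_sorted: "is_partition la \<Longrightarrow> sorted_wrt (>) (beta_list la)"
  by (induction la) (simp_all add: is_partition_Cons beta_list_less)

lemma beta_list_inj: "beta_list la = beta_list nu \<Longrightarrow> la = nu"
proof (induction la arbitrary: nu)
  case Nil
  then show ?case by (cases nu) auto
next
  case (Cons x xs)
  then show ?case by (cases nu) (auto dest: arg_cong[of _ _ length])
qed

lemma beta_list_surj:
  assumes "sorted_wrt (>) hs" "\<forall>h\<in>set hs. 0 < h"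
  shows "\<exists>la. is_partition la \<and> beta_list la = hs"
  using assms
proof (induction hs)
  case Nil
  then show ?case by (auto simp: is_partition_def intro: exI[of _ "[]"])
next
  case (Cons h hs)
  then obtain la where la: "is_partition la" "beta_list la = hs" by auto
  have len: "length la = length hs" using la(2) by auto
  have *: "y + length hs \<le> h \<and> 0 < y" if "y \<in> set la" for y
  proof (cases la)
    case (Cons z zs)
    then have "z + length zs < h" using la(2) Cons.prems by auto
    moreover have "y \<le> z" using that la(1) Cons by (auto simp: is_partition_Cons)
    moreover have "0 < y" using that la(1) by (auto simp: is_partition_def)
    ultimately show ?thesis using len Cons by auto
  qed (use that in auto)
  have "length hs < h"
  proof (cases la)
    case Nil
    then show ?thesis using len Cons.prems by simp
  next
    case (Cons y ys)
    then show ?thesis using *[of y] by simp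
  qed
  then have "is_partition ((h - length hs) # la) \<and> beta_list ((h - length hs) # la) = h # hs"
    using * la len \<open>length hs < h\<close> by (simp add: is_partition_Cons le_diff_conv2)
  then show ?case by blast
qed

lemma ex1_partition_beta_set:
  assumes "finite H" "0 \<notin> H"
  shows "\<exists>!la. is_partition la \<and> beta_set la = H"
proof (rule ex_ex1I)
  have "sorted_wrt (>) (rev (sorted_list_of_set H))"
    using strict_sorted_list_of_set[of H] by (simp add: sorted_wrt_rev)
  moreover have "\<forall>h\<in>set (rev (sorted_list_of_set H)). 0 < h"
    using assms by (auto intro: gr0I)
  ultimately obtain la where "is_partition la" "beta_list la = rev (sorted_list_of_set H)"
    using beta_list_surj[of "rev (sorted_list_of_set H)"] by metis
  then show "\<exists>la. is_partition la \<and> beta_set la = H"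
    using assms by (auto simp: beta_set_eq)
next
  fix la nu
  assume A: "is_partition la \<and> beta_set la = H" "is_partition nu \<and> beta_set nu = H"
  have "sorted_wrt (<) (rev (beta_list la))" "sorted_wrt (<) (rev (beta_list nu))"
    using A beta_list_sorted by (auto simp: sorted_wrt_rev)
  moreover have "set (rev (beta_list la)) = set (rev (beta_list nu))"
    using A by (metis set_rev beta_set_eq)
  ultimately have "rev (beta_list la) = rev (beta_list nu)"
    by (metis strict_sorted_equal)
  then show "la = nu" by (simp add: beta_list_inj)
qed

lemma ex1_mu: "\<exists>!la. is_partition la \<and> beta_set la = mu_beta k"
proof (rule ex1_partition_beta_set)
  have "mu_beta k \<subseteq>
      (\<lambda>(s, i). 2*i - 1 + (s - 1) * (2*k + 3)) ` ({..k} \<times> {..k + 1})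
      \<union> (\<lambda>p. 2*k + 2 + p * (2*k + 3)) ` {..k}"
    unfolding mu_beta_def by (force simp: image_iff)
  then show "finite (mu_beta k)" by (rule finite_subset) auto
  show "0 \<notin> mu_beta k" by (auto simp: mu_beta_def)
qed

end

theory Submission
  imports Defs
begin

text \<open>
  Every \<open>(2k+1, 2k+3)\<close>-core with distinct parts is contained, part by part, in \<open>mu k\<close>, so a core
  of maximal size equals \<open>mu k\<close>. A part is the number of gaps of the \<open>\<beta>\<close>-set \<open>H\<close> below the
  corresponding bead, so one has to bound the gaps below a bead \<open>x\<close> with exactly \<open>N\<close> beads \<open>\<ge> x\<close>.
  Put \<open>t = 2k+3\<close>. Since \<open>H\<close> is closed under subtracting \<open>t\<close> and \<open>t - 2\<close>, and has no consecutive
  elements, a nonempty window \<open>{x+t..<x+2t}\<close> holds strictly fewer beads than \<open>{x..<x+t}\<close>, and no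
  window holds more than \<open>k + 1\<close>. Hence \<open>N\<close> is at most a triangular number in the size of the
  window at \<open>x\<close>, and the windows below \<open>x\<close> grow by at least one each, which leaves few gaps. The
  resulting bounds are attained by \<open>mu k\<close>.
\<close>

section \<open>Windows of length \<open>2 * k + 3\<close> in a set of beads\<close>

lemma card_no_consecutive:
  fixes H :: "nat set"
  assumes "\<And>h. h \<in> H \<Longrightarrow> Suc h \<notin> H"
  shows "card (H \<inter> {a..<a + 2 * m}) \<le> m"
proof (induction m)
  case (Suc m)
  have "H \<inter> {a..<a + 2 * Suc m} =
      (H \<inter> {a..<a + 2 * m}) \<union> (H \<inter> {a + 2 * m, Suc (a + 2 * m)})"
    by auto
  moreover have "card (H \<inter> {a + 2 * m, Suc (a + 2 * m)}) \<le> 1"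
    using assms[of "a + 2 * m"] by (auto simp: Int_insert_right)
  ultimately show ?case
    using Suc card_Un_le[of "H \<inter> {a..<a + 2 * m}" "H \<inter> {a + 2 * m, Suc (a + 2 * m)}"] by simp
qed simp

text \<open>These are the properties of the \<open>\<beta>\<close>-set of a
  \<open>(2k+1, 2k+3)\<close>-core with distinct parts: subtraction closure encodes the two core
  conditions, \<open>sparse\<close> the distinctness. The equivalence is
  \<open>distinct_core_iff\<close>.\<close>

locale twin_core_beads =
  fixes k :: nat and H :: "nat set"
  assumes fin: "finite H"
    and zero: "0 \<notin> H"
    and down_t: "\<And>h. h \<in> H \<Longrightarrow> 2 * k + 3 \<le> h \<Longrightarrow> h - (2 * k + 3) \<in> H"
    and down_n: "\<And>h. h \<in> H \<Longrightarrow> 2 * k + 1 \<le> h \<Longrightarrow> h - (2 * k + 1) \<in> H"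
    and sparse: "\<And>h. h \<in> H \<Longrightarrow> Suc h \<notin> H"
begin

abbreviation "t \<equiv> 2 * k + 3"

abbreviation window :: "nat \<Rightarrow> nat" where
  "window x \<equiv> card (H \<inter> {x..<x + t})"

abbreviation count_from :: "nat \<Rightarrow> nat" where
  "count_from x \<equiv> card (H \<inter> {x..})"

abbreviation count_below :: "nat \<Rightarrow> nat" where
  "count_below x \<equiv> card (H \<inter> {..<x})"

lemma t_notin: "t \<notin> H" and n_notin: "2 * k + 1 \<notin> H"
  using down_t[of t] down_n[of "2 * k + 1"] zero by auto

lemma down_t': "y + t \<in> H \<Longrightarrow> y \<in> H"
  using down_t[of "y + t"] by simp

text \<open>The two moduli differ by \<open>2\<close>, so going up by \<open>t\<close> and down by
  \<open>2 * k + 1\<close> is a step of \<open>2\<close>. This is how a bead kept one window higher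
  influences its own window.\<close>

lemma up_two: "y + t \<in> H \<Longrightarrow> y + 2 \<in> H"
  using down_n[of "y + t"] by (simp add: numeral_eq_Suc)

lemma down_mult: "y + q * t \<in> H \<Longrightarrow> y \<in> H"
proof (induction q)
  case (Suc q)
  then have "(y + q * t) + t \<in> H" by (simp add: algebra_simps)
  then show ?case using down_t' Suc.IH by blast
qed simp

lemma card_split: "a \<le> b \<Longrightarrow> b \<le> c \<Longrightarrow>
    card (H \<inter> {a..<c}) = card (H \<inter> {a..<b}) + card (H \<inter> {b..<c})"
  by (subst card_Un_disjoint[symmetric]) (auto intro!: arg_cong[of _ _ card])

lemma count_from_split: "a \<le> b \<Longrightarrow> count_from a = card (H \<inter> {a..<b}) + count_from b"
  using fin by (subst card_Un_disjoint[symmetric]) (auto intro!: arg_cong[of _ _ card])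

lemma count_below_split: "a \<le> b \<Longrightarrow> count_below b = count_below a + card (H \<inter> {a..<b})"
  using fin by (subst card_Un_disjoint[symmetric]) (auto intro!: arg_cong[of _ _ card])

lemma shift_card_le: "card (H \<inter> {a + t..<b + t}) \<le> card (H \<inter> {a..<b})"
proof (rule card_inj_on_le[of "\<lambda>h. h - t"])
  show "(\<lambda>h. h - t) ` (H \<inter> {a + t..<b + t}) \<subseteq> H \<inter> {a..<b}"
    using down_t by auto
qed (auto simp: inj_on_def)

lemma shift_card_less:
  assumes "y \<in> H" "a \<le> y" "y < b" "y + t \<notin> H"
  shows "card (H \<inter> {a + t..<b + t}) < card (H \<inter> {a..<b})"
proof -
  have "card (H \<inter> {a + t..<b + t}) \<le> card (H \<inter> {a..<b} - {y})"
  proof (rule card_inj_on_le[of "\<lambda>h. h - t"])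
    show "(\<lambda>h. h - t) ` (H \<inter> {a + t..<b + t}) \<subseteq> H \<inter> {a..<b} - {y}"
      using down_t assms(4) by auto
  qed (auto simp: inj_on_def)
  also have "\<dots> < card (H \<inter> {a..<b})"
    using assms by (intro card_Diff1_less) auto
  finally show ?thesis .
qed

text \<open>The last step may start just below \<open>b\<close>, so the run can end as far as
  \<open>b + 1\<close>.\<close>

lemma add_two_closed:
  assumes "z \<in> H" "\<And>y. y \<in> H \<Longrightarrow> z \<le> y \<Longrightarrow> y < b \<Longrightarrow> y + 2 \<in> H"
  shows "z + 2 * m \<le> b + 1 \<Longrightarrow> z + 2 * m \<in> H"
proof (induction m)
  case (Suc m)
  then show ?case using assms(2)[of "z + 2 * m"] by simp
qed (use assms in simp)

text \<open>If no bead of the lower window is lost, the window is closed under adding \<open>2\<close>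
  modulo the odd number \<open>t\<close>, hence contains all residues.\<close>

lemma window_step:
  assumes "H \<inter> {x + t..<x + t + t} \<noteq> {}"
  shows "window (x + t) < window x"
proof (rule ccontr)
  assume "\<not> ?thesis"
  \<comment> \<open>Subtracting \<open>t\<close> maps the upper window injectively into the lower
    one; without a strict drop no bead of the lower window is missed.\<close>
  then have up: "y + t \<in> H" if "y \<in> H" "x \<le> y" "y < x + t" for y
    using shift_card_less[of y x "x + t"] that by auto
  have up2: "y + 2 \<in> H" if "y \<in> H" "x \<le> y" "y < x + t" for y
    using up[OF that] up_two by blast
  have 0: "\<not> (x + 2 * k + 1 \<in> H \<and> x + 2 * k + 2 \<in> H)"
    using sparse[of "x + 2 * k + 1"] by simp
  have even_run: "x + 2 * k + 2 \<in> H" if "x \<in> H"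
    using add_two_closed[of x "x + t" "k + 1", OF that up2] by simp
  have odd_run: "x + 2 * k + 1 \<in> H" if "x + 1 \<in> H"
    using add_two_closed[of "x + 1" "x + t" k, OF that up2] by simp
  \<comment> \<open>Adding \<open>2\<close> at the last two offsets leaves the window; reducing by
    \<open>t\<close> re-enters it at offsets \<open>0\<close> and \<open>1\<close>, with the other
    parity.\<close>
  have wrap_even: "x \<in> H" if "x + 2 * k + 1 \<in> H"
    using up2[OF that] down_t'[of x] by (simp add: eval_nat_numeral)
  have wrap_odd: "x + 1 \<in> H" if "x + 2 * k + 2 \<in> H"
    using up2[OF that] down_t'[of "x + 1"] by (simp add: eval_nat_numeral)
  obtain h where "h \<in> H" "x + t \<le> h" "h < x + t + t" using assms by auto
  then have y: "h - t \<in> H" "x \<le> h - t" "h - t < x + t" using down_t by auto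
  define d where "d = h - t - x"
  have d: "h - t = x + d" "d < t" using y by (auto simp: d_def)
  show False
  proof (cases "even d")
    case True
    then obtain e where e: "d = 2 * e" by blast
    then have "x + d + 2 * (k + 1 - e) \<in> H"
      using add_two_closed[of "x + d" "x + t" "k + 1 - e"] up2 y d by simp
    then have "x + 2 * k + 2 \<in> H" using e d by (simp add: algebra_simps)
    \<comment> \<open>One parity class runs to the top, wraps round and fills the other, which puts
      beads at the consecutive offsets \<open>2 * k + 1\<close> and
      \<open>2 * k + 2\<close>.\<close>
    then show False using wrap_odd odd_run 0 by blast
  next
    case False
    then obtain e where e: "d = 2 * e + 1" by (rule oddE)
    then have "x + d + 2 * (k - e) \<in> H"
      using add_two_closed[of "x + d" "x + t" "k - e"] up2 y d by simp
    then have "x + 2 * k + 1 \<in> H" using e d by (simp add: algebra_simps)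
    then show False using wrap_even even_run 0 by blast
  qed
qed

lemma window_Suc_eq:
  "window x + (if x + t \<in> H then 1 else 0) = window (Suc x) + (if x \<in> H then 1 else 0)"
proof -
  have "window x = card (H \<inter> {x..<Suc x}) + card (H \<inter> {Suc x..<x + t})"
    by (rule card_split) auto
  moreover have "window (Suc x) = card (H \<inter> {Suc x..<x + t}) + card (H \<inter> {x + t..<Suc (x + t)})"
    using card_split[of "Suc x" "x + t" "Suc (x + t)"] by (simp only: add_Suc)
  moreover have "card (H \<inter> {x..<Suc x}) = (if x \<in> H then 1 else 0)"
      "card (H \<inter> {x + t..<Suc (x + t)}) = (if x + t \<in> H then 1 else 0)"
    by (simp_all only: atLeastLessThanSuc) auto
  ultimately show ?thesis by linarith
qed

text \<open>A bead \<open>x + t\<close> entering on the right forces the bead \<open>x\<close>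
  leaving on the left.\<close>

lemma window_Suc_le: "window (Suc x) \<le> window x"
  using window_Suc_eq[of x] down_t'[of x] by (auto split: if_splits)

lemma window_antimono: "x \<le> y \<Longrightarrow> window y \<le> window x"
  by (rule lift_Suc_antimono_le[of window, OF window_Suc_le])

text \<open>Both \<open>0\<close> and \<open>2 * k + 1\<close> are gaps, so only the
  \<open>2 * k\<close> positions between them matter.\<close>

lemma count_below_t1: "count_below (2 * k + 2) \<le> k"
proof -
  have "H \<inter> {..<2 * k + 2} = H \<inter> {1..<1 + 2 * k}"
  proof (intro set_eqI iffI)
    fix h assume "h \<in> H \<inter> {..<2 * k + 2}"
    then have "h \<in> H" "h < 2 * k + 2" by auto
    moreover have "h \<noteq> 0" "h \<noteq> 2 * k + 1" using \<open>h \<in> H\<close> zero n_notin by metis+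
    ultimately show "h \<in> H \<inter> {1..<1 + 2 * k}" by auto
  qed auto
  then show ?thesis using card_no_consecutive[of H 1 k] sparse by simp
qed

lemma window_0_le:
  "window 0 \<le> count_below (2 * k + 2) + (if 2 * k + 2 \<in> H then 1 else 0)"
proof -
  have "window 0 = card (H \<inter> {0..<2 * k + 2}) + card (H \<inter> {2 * k + 2..<t})"
    using card_split[of 0 "2 * k + 2" t] by simp
  moreover have "H \<inter> {2 * k + 2..<t} = (if 2 * k + 2 \<in> H then {2 * k + 2} else {})"
    by (auto simp: less_Suc_eq eval_nat_numeral)
  ultimately show ?thesis by (simp add: atLeast0LessThan)
qed

lemma window_le: "window x \<le> k + 1"
  using window_0_le window_antimono[of 0 x] count_below_t1 by (auto split: if_splits)

lemma one_mem: "2 * k + 2 \<in> H \<Longrightarrow> 1 \<in> H"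
  using down_n[of "2 * k + 2"] by simp

text \<open>Apart from position \<open>2 * k + 2\<close>, this window is a shift by \<open>t\<close>
  of the positions below \<open>2 * k + 2\<close>. If that position is a bead, so is
  \<open>1\<close>; a lossless shift would then carry \<open>1\<close> in steps of \<open>2\<close>
  to the gap \<open>2 * k + 1\<close>, so one bead is lost in compensation.\<close>

lemma window_t1_le: "window (2 * k + 2) \<le> count_below (2 * k + 2)"
proof -
  have "window (2 * k + 2) = card (H \<inter> {2 * k + 2..<t}) + card (H \<inter> {t..<4 * k + 5})"
    using card_split[of "2 * k + 2" t "4 * k + 5"] by (simp add: algebra_simps)
  moreover have "H \<inter> {2 * k + 2..<t} = (if 2 * k + 2 \<in> H then {2 * k + 2} else {})"
    by (auto simp: less_Suc_eq eval_nat_numeral)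
  moreover have "card (H \<inter> {t..<4 * k + 5}) < count_below (2 * k + 2)" if "2 * k + 2 \<in> H"
  proof (rule ccontr)
    assume *: "\<not> ?thesis"
    have "y + 2 \<in> H" if "y \<in> H" "y < 2 * k + 2" for y
      using shift_card_less[of y 0 "2 * k + 2"] that * up_two[of y]
      by (auto simp: atLeast0LessThan add.commute)
    then have "1 + 2 * k \<in> H"
      using add_two_closed[of 1 "2 * k + 2" k] one_mem[OF that] by simp
    then show False using n_notin by simp
  qed
  moreover have "card (H \<inter> {t..<4 * k + 5}) \<le> count_below (2 * k + 2)"
    using shift_card_le[of 0 "2 * k + 2"] by (simp add: atLeast0LessThan add.commute)
  ultimately show ?thesis by (auto split: if_splits)
qed

section \<open>Bounds on the numbers of beads and gaps\<close>

text \<open>Successive windows above \<open>x\<close> hold at most \<open>w\<close>,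
  \<open>w - 1\<close>, ... beads. Once a window is empty nothing lies above it, since any bead
  there reduces modulo \<open>t\<close> into the window.\<close>

lemma count_from_le: "window x \<le> w \<Longrightarrow> 2 * count_from x \<le> w * (w + 1)"
proof (induction w arbitrary: x)
  case 0
  have "H \<inter> {x..} = {}"
  proof (rule ccontr)
    assume "H \<inter> {x..} \<noteq> {}"
    then obtain h where h: "h \<in> H" "x \<le> h" by auto
    define z where "z = x + (h - x) mod t"
    have "h = z + (h - x) div t * t"
      using h(2) mod_div_mult_eq[of "h - x" t] unfolding z_def by linarith
    then have "z \<in> H" using down_mult h(1) by metis
    moreover have "z \<in> {x..<x + t}" by (simp add: z_def)
    ultimately show False using 0 by auto
  qed
  then show ?case by simp
next
  case (Suc w)
  have "window (x + t) \<le> w"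
    using window_step[of x] Suc.prems by (cases "window (x + t) = 0") auto
  then have "2 * count_from (x + t) \<le> w * (w + 1)" by (rule Suc.IH)
  then show ?case
    using count_from_split[of x "x + t"] Suc.prems by simp
qed

text \<open>Descending from \<open>x + q * t\<close>, the windows hold at least
  \<open>v + 1\<close>, ..., \<open>v + q\<close> beads; the second bound is twice their
  sum.\<close>

lemma window_chain:
  assumes "v \<le> window (x + q * t)" "0 < v"
  shows "v + q \<le> window x \<and> 2 * q * v + q * (q + 1) \<le> 2 * card (H \<inter> {x..<x + q * t})"
  using assms
proof (induction q arbitrary: v)
  case (Suc q)
  have "x + Suc q * t = x + q * t + t" by simp
  then have *: "v \<le> window (x + q * t + t)" using Suc.prems(1) by (simp only:)
  then have "0 < window (x + q * t + t)" using Suc.prems(2) by linarith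
  then have "window (x + q * t + t) < window (x + q * t)"
    unfolding card_gt_0_iff using window_step by blast
  with * have "v < window (x + q * t)" by linarith
  then have v: "Suc v \<le> window (x + q * t)" by simp
  have "card (H \<inter> {x..<x + Suc q * t}) = card (H \<inter> {x..<x + q * t}) + window (x + q * t)"
    using card_split[of x "x + q * t" "x + Suc q * t"] by (simp add: algebra_simps)
  then show ?case using Suc.IH[OF v] v by (simp add: algebra_simps)
qed simp

text \<open>The cut at \<open>2 * k + 2\<close> matters: counting from \<open>0\<close> with a first
  window of \<open>k + 1\<close> would give a bound larger by one bead.\<close>

lemma card_H_le: "2 * card H \<le> k * (k + 3)"
proof -
  have "H = H \<inter> {0..}" by auto
  then have "card H = count_below (2 * k + 2) + count_from (2 * k + 2)"
    using count_from_split[of 0 "2 * k + 2"] by (simp add: atLeast0LessThan)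
  then show ?thesis
    using count_from_le[of "2 * k + 2" k] window_t1_le count_below_t1 by (simp add: algebra_simps)
qed

text \<open>Since \<open>k + 1\<close> is the maximum, every window starting at or below
  \<open>\<rho>\<close> is full too. This rigidity forces all odd numbers up to
  \<open>\<rho>\<close> to be beads.\<close>

lemma full_window:
  assumes "\<rho> \<in> H" "\<rho> < t" "k + 1 \<le> window \<rho>"
  obtains i where "\<rho> = 2 * i + 1" "i < k" "i \<le> count_below \<rho>"
proof -
  have w: "window y = k + 1" if "y \<le> \<rho>" for y
    using window_antimono[OF that] window_le[of y] assms(3) by simp
  \<comment> \<open>At most \<open>k\<close> beads lie below \<open>2 * k + 2\<close>, so a full
    window at \<open>0\<close> must contain \<open>2 * k + 2\<close>.\<close>
  then have one: "1 \<in> H"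
    using window_0_le count_below_t1 one_mem w[of 0] by (auto split: if_splits)
  have up2: "y + 2 \<in> H" if "y \<in> H" "y < \<rho>" for y
  proof -
    \<comment> \<open>Sliding by one keeps the window full, so the departing bead \<open>y\<close>
      is replaced by \<open>y + t\<close>.\<close>
    have "(if y + t \<in> H then 1 else 0) = (if y \<in> H then 1 else (0::nat))"
      using window_Suc_eq[of y] unfolding w[OF less_imp_le[OF that(2)]] w[OF Suc_leI[OF that(2)]]
      by (rule add_left_imp_eq)
    then have "y + t \<in> H" using that(1) by presburger
    then show ?thesis by (rule up_two)
  qed
  have mem: "2 * m + 1 \<in> H" if "2 * m \<le> \<rho>" for m
    using add_two_closed[of 1 \<rho> m] one up2 that by simp
  have "odd \<rho>"
  proof
    assume "even \<rho>"
    then obtain m where "\<rho> = 2 * m" by blast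
    then show False using mem[of m] assms(1) sparse[of \<rho>] by simp
  qed
  then obtain i where i: "\<rho> = 2 * i + 1" by (rule oddE)
  have "i < k" using assms i n_notin by (cases "i = k") auto
  moreover have "i \<le> count_below \<rho>"
  proof -
    have "card ((\<lambda>m. 2 * m + 1) ` {..<i}) \<le> count_below \<rho>"
      using mem i by (intro card_mono) auto
    then show ?thesis by (simp add: card_image inj_on_def)
  qed
  ultimately show thesis using that i by blast
qed

text \<open>Each row, cut off after offset \<open>2 * k + 1\<close>, loses a bead when moved up by
  \<open>t\<close>: otherwise its odd first offset would propagate in steps of \<open>2\<close> to
  \<open>l * t + 2 * k + 1\<close>, which reduces to the gap \<open>2 * k + 1\<close>.\<close>

lemma truncated_rows:
  assumes "odd \<rho>" "\<rho> < 2 * k + 1"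
  shows "l * t + \<rho> \<in> H \<Longrightarrow>
    card (H \<inter> {l * t + \<rho>..<l * t + 2 * k + 2}) + l \<le> card (H \<inter> {\<rho>..<2 * k + 2})"
proof (induction l)
  case (Suc l)
  let ?a = "l * t + \<rho>" and ?b = "l * t + 2 * k + 2"
  have a: "?a \<in> H" using Suc.prems down_t'[of ?a] by (simp add: algebra_simps)
  have "card (H \<inter> {?a + t..<?b + t}) < card (H \<inter> {?a..<?b})"
  proof (rule ccontr)
    assume *: "\<not> ?thesis"
    have up2: "y + 2 \<in> H" if "y \<in> H" "?a \<le> y" "y < ?b" for y
      using shift_card_less[of y ?a ?b] that * up_two[of y] by auto
    obtain i where i: "\<rho> = 2 * i + 1" using assms(1) by (rule oddE)
    have "?a + 2 * (k - i) \<in> H"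
      using add_two_closed[of ?a ?b "k - i"] a up2 i assms(2) by simp
    then have "(2 * k + 1) + l * t \<in> H" using i assms(2) by (simp add: algebra_simps)
    then show False using down_mult n_notin by blast
  qed
  moreover have "Suc l * t + \<rho> = ?a + t" "Suc l * t + 2 * k + 2 = ?b + t" by simp_all
  ultimately show ?case using Suc.IH[OF a] by (simp only:)
qed simp

text \<open>The pair \<open>(j, u)\<close> names the bead of \<open>mu_beta k\<close> with the same
  number of beads at or above it as \<open>x\<close> has in \<open>H\<close>. The difference
  \<open>x - count_below x\<close> is the part belonging to \<open>x\<close>, and the bound is the
  corresponding part of \<open>mu k\<close>.\<close>

lemma gaps_below_le:
  assumes x: "x \<in> H" and j: "j \<le> k" and u: "u \<le> k - j"
    and N: "2 * count_from x = (k - j) * (k - j + 1) + 2 * (k - j - u + 1)"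
  shows "2 * x \<le> 2 * count_below x + 2 * u + j * (2 * k + 3 + j)"
proof -
  \<comment> \<open>\<open>v\<close> is the least possible size of the window at \<open>x\<close>:
    with fewer beads there, \<open>count_from_le\<close> would contradict \<open>N\<close>.\<close>
  define v where "v = k + 1 - j"
  have v: "0 < v" "k + 1 = v + j" using j by (auto simp: v_def)
  have kj: "k - j = v - 1" using v by simp
  define q where "q = x div t"
  define \<rho> where "\<rho> = x mod t"
  have xq: "x = \<rho> + q * t" unfolding q_def \<rho>_def by (rule mod_div_mult_eq[symmetric])
  have \<rho>: "\<rho> < t" "\<rho> \<in> H"
    using x down_mult[of \<rho> q] by (simp_all only: xq[symmetric]) (simp add: \<rho>_def)
  have wx: "v \<le> window x"
  proof (rule ccontr)
    assume "\<not> ?thesis"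
    then have "window x \<le> v - 1" by simp
    then have "2 * count_from x \<le> (v - 1) * (v - 1 + 1)" by (rule count_from_le)
    then show False using N unfolding kj by simp
  qed
  then have "v \<le> window (\<rho> + q * t)" by (simp only: xq[symmetric])
  then have chain: "v + q \<le> window \<rho>"
      "2 * q * v + q * (q + 1) \<le> 2 * card (H \<inter> {\<rho>..<\<rho> + q * t})"
    using window_chain v(1) by blast+
  have below: "count_below x = count_below \<rho> + card (H \<inter> {\<rho>..<\<rho> + q * t})"
    by (subst xq) (rule count_below_split, simp)
  have mono: "X \<le> 2 * c + U + Q" if "X \<le> 2 * a + P + U + Q" "c = a + d" "P \<le> 2 * d"
    for X a P U Q c d :: nat
    using that by linarith
  \<comment> \<open>The beads between \<open>\<rho>\<close> and \<open>x\<close> are replaced by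
    their lower bound from \<open>chain\<close>, leaving only the gaps below \<open>\<rho>\<close>
    to estimate.\<close>
  have reduce: ?thesis
    if "2 * (\<rho> + q * t) \<le> 2 * count_below \<rho> + (2 * q * v + q * (q + 1)) + 2 * u + j * (2 * k + 3 + j)"
    using mono[OF that below chain(2)] by (simp only: xq[symmetric])
  obtain w where w: "v = Suc w" using v(1) gr0_conv_Suc by blast
  have "q \<le> j" using chain(1) window_le[of \<rho>] v by simp
  then consider "q = j" | "j = q + 1" | "q + 2 \<le> j" by linarith
  then show ?thesis
  proof cases
    case 1
    have "k + 1 \<le> window \<rho>" using chain(1) 1 v by simp
    then obtain i where i: "\<rho> = 2 * i + 1" "i < k" "i \<le> count_below \<rho>"
      using full_window \<rho> by metis
    \<comment> \<open>\<open>?top\<close> ends the truncated row \<open>j\<close>. A window of size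
      \<open>v\<close> there would force \<open>k + 1\<close> beads into the window at
      \<open>2 * k + 2\<close>, which has at most \<open>k\<close>. So the beads from
      \<open>?top\<close> on are few, and \<open>N\<close> puts the rest in row
      \<open>j\<close>.\<close>
    let ?top = "j * t + 2 * k + 2"
    have "window ?top \<le> v - 1"
    proof (rule ccontr)
      assume "\<not> ?thesis"
      then have "v + j \<le> window (2 * k + 2)"
        using window_chain[of v "2 * k + 2" j] v by (simp add: algebra_simps)
      then show False using window_t1_le count_below_t1 v by simp
    qed
    then have "2 * count_from ?top \<le> (v - 1) * (v - 1 + 1)" by (rule count_from_le)
    moreover have "count_from x = card (H \<inter> {x..<?top}) + count_from ?top"
      using xq i 1 by (intro count_from_split) auto
    ultimately have "k - j - u + 1 \<le> card (H \<inter> {j * t + \<rho>..<?top})"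
      using N xq 1 kj by (simp add: add.commute)
    also have "\<dots> + j \<le> card (H \<inter> {\<rho>..<2 * k + 2})"
      using truncated_rows[of \<rho> j] i x xq 1 by (simp add: add.commute)
    also have "\<dots> \<le> k - i"
    proof -
      have "H \<inter> {\<rho>..<2 * k + 2} = H \<inter> {\<rho>..<\<rho> + 2 * (k - i)}"
        using i n_notin by (auto simp: less_Suc_eq)
      then show ?thesis using card_no_consecutive[of H \<rho> "k - i"] sparse by simp
    qed
    \<comment> \<open>The inequalities give \<open>i < u\<close>, while at least \<open>i\<close>
      beads lie below \<open>\<rho> = 2 * i + 1\<close>.\<close>
    finally have "\<rho> \<le> count_below \<rho> + u" using i u by simp
    moreover have "k = w + j" using v(2) w by simp
    ultimately show ?thesis by (intro reduce) (simp add: 1 w algebra_simps)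
  next
    case 2
    have kq: "k = v + q" using v 2 by simp
    \<comment> \<open>With \<open>q\<close> one less than \<open>j\<close>, up to
      \<open>k + 2\<close> gaps below \<open>\<rho>\<close> are affordable. Window \<open>0\<close>
      has at least \<open>k\<close> beads, and those not below \<open>\<rho>\<close> avoid
      \<open>2 * k + 1\<close>.\<close>
    have "\<rho> \<le> count_below \<rho> + k + 2"
    proof (cases "\<rho> = 2 * k + 2")
      case True
      then show ?thesis using window_t1_le chain(1) kq by simp
    next
      case False
      have "\<rho> \<le> 2 * k" using \<rho> False n_notin by (cases "\<rho> = 2 * k + 1") auto
      have "k \<le> card (H \<inter> {..<t})"
        using chain(1) window_antimono[of 0 \<rho>] kq by (simp add: atLeast0LessThan)
      also have "\<dots> \<le> card ((H \<inter> {..<\<rho>}) \<union> ({\<rho>..<t} - {2 * k + 1}))"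
        using n_notin by (intro card_mono) auto
      also have "\<dots> \<le> count_below \<rho> + card ({\<rho>..<t} - {2 * k + 1})"
        by (rule card_Un_le)
      also have "card ({\<rho>..<t} - {2 * k + 1}) = t - \<rho> - 1"
        using \<open>\<rho> \<le> 2 * k\<close> by simp
      finally show ?thesis using \<open>\<rho> \<le> 2 * k\<close> by simp
    qed
    then show ?thesis by (intro reduce) (simp add: kq 2 algebra_simps)
  next
    case 3
    then obtain d where 3: "j = q + 2 + d" using le_Suc_ex by blast
    have kq: "k = v + q + d + 1" using v 3 by simp
    \<comment> \<open>This far down, the bound has enough slack for \<open>\<rho> < t\<close>
      alone.\<close>
    have "\<rho> \<le> 2 * k + 2" using \<rho> by simp
    then show ?thesis by (intro reduce) (simp add: kq 3 w algebra_simps)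
  qed
qed

end

section \<open>\<open>\<beta>\<close>-sets of partitions: ranks of beads, hooks and cores\<close>

lemma partition_nth_antimono:
  assumes "is_partition la" "i \<le> j" "j < length la"
  shows "la ! j \<le> la ! i"
  using assms sorted_wrt_nth_less[of "(\<ge>)" la i j]
  by (cases "i = j") (auto simp: is_partition_def)

lemma partition_nth_pos: "is_partition la \<Longrightarrow> i < length la \<Longrightarrow> 0 < la ! i"
  by (auto simp: is_partition_def)

lemma beta_list_strict:
  assumes "is_partition la" "i < j" "j < length la"
  shows "beta_list la ! j < beta_list la ! i"
  using sorted_wrt_nth_less[OF beta_list_sorted[OF assms(1)], of i j] assms by simp

lemma beta_list_nth_le_iff:
  assumes "is_partition la" "i < length la" "j < length la"
  shows "beta_list la ! i \<le> beta_list la ! j \<longleftrightarrow> j \<le> i"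
  using beta_list_strict[OF assms(1), of i j] beta_list_strict[OF assms(1), of j i] assms
  by (cases i j rule: linorder_cases) auto

lemma beta_set_conv: "is_partition la \<Longrightarrow> beta_set la = (\<lambda>i. beta_list la ! i) ` {..<length la}"
  by (auto simp: beta_set_eq set_conv_nth)

lemma inj_on_beta_list:
  assumes "is_partition la"
  shows "inj_on (\<lambda>i. beta_list la ! i) {..<length la}"
proof (rule inj_onI)
  fix i j assume "i \<in> {..<length la}" "j \<in> {..<length la}" "beta_list la ! i = beta_list la ! j"
  then show "i = j"
    using beta_list_nth_le_iff[OF assms, of i j] beta_list_nth_le_iff[OF assms, of j i] by auto
qed

lemma card_beta_set: "is_partition la \<Longrightarrow> card (beta_set la) = length la"
  by (simp add: beta_set_conv card_image inj_on_beta_list)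

lemma card_beta_set_from:
  assumes "is_partition la" "i < length la"
  shows "card (beta_set la \<inter> {beta_list la ! i..}) = Suc i"
proof -
  have "beta_set la \<inter> {beta_list la ! i..} = (\<lambda>j. beta_list la ! j) ` {..i}"
    using assms by (auto simp: beta_set_conv beta_list_nth_le_iff)
  moreover have "inj_on (\<lambda>j. beta_list la ! j) {..i}"
    using inj_on_beta_list[OF assms(1)] by (rule inj_on_subset) (use assms in auto)
  ultimately show ?thesis by (simp add: card_image)
qed

lemma card_beta_set_below:
  assumes "is_partition la" "i < length la"
  shows "card (beta_set la \<inter> {..<beta_list la ! i}) = length la - 1 - i"
proof -
  have "beta_set la \<inter> {..<beta_list la ! i} = (\<lambda>j. beta_list la ! j) ` {Suc i..<length la}"
    using assms by (auto simp: beta_set_conv beta_list_nth_le_iff linorder_not_le[symmetric])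
  moreover have "inj_on (\<lambda>j. beta_list la ! j) {Suc i..<length la}"
    using inj_on_beta_list[OF assms(1)] by (rule inj_on_subset) auto
  ultimately show ?thesis by (simp add: card_image)
qed

text \<open>Here \<open>m\<close> is the row just below the leg of the hook at \<open>(i, j)\<close>.\<close>

lemma hook_length_leg:
  assumes la: "is_partition la" and m: "i < m" "m \<le> length la"
    and leg: "j < la ! (m - 1)" and foot: "m < length la \<Longrightarrow> la ! m \<le> j"
  shows "hook_length la (i, j) + (length la - m + j) = beta_list la ! i"
    and "length la - m + j \<notin> beta_set la"
proof -
  have above: "j < la ! i'" if "i' < m" for i'
  proof -
    have "i' \<le> m - 1" "m - 1 < length la" using that m by auto
    then show ?thesis using leg partition_nth_antimono[OF la] less_le_trans by blast
  qed
  have beneath: "la ! i' \<le> j" if "m \<le> i'" "i' < length la" for i'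
    using partition_nth_antimono[OF la, of m i'] that foot by simp
  have "{i'. i < i' \<and> (i', j) \<in> young_diagram la} = {Suc i..<m}"
    using above beneath m by (auto simp: young_diagram_def not_le[symmetric])
  moreover have "{j'. j < j' \<and> (i, j') \<in> young_diagram la} = {Suc j..<la ! i}"
    using m by (auto simp: young_diagram_def)
  ultimately have "hook_length la (i, j) = (la ! i - Suc j) + (m - Suc i) + 1"
    by (simp add: hook_length_def)
  then show "hook_length la (i, j) + (length la - m + j) = beta_list la ! i"
    using above[of i] m by (simp add: nth_beta_list)
  show "length la - m + j \<notin> beta_set la"
  proof
    assume "length la - m + j \<in> beta_set la"
    then obtain i' where i': "i' < length la" "length la - m + j = la ! i' + (length la - 1 - i')"
      using la by (auto simp: beta_set_conv nth_beta_list)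
    then show False using above[of i'] beneath[of i'] m by (cases "i' < m") auto
  qed
qed

text \<open>With \<open>m\<close> the first row below \<open>i\<close> that does not reach column
  \<open>j\<close>, the foot of the leg determines the gap. With the converse
  \<open>ex_hook_of_gap\<close>, the hook lengths in row \<open>i\<close> are the differences
  between its bead and the smaller gaps.\<close>

lemma ex_gap_of_hook:
  assumes la: "is_partition la" and ij: "(i, j) \<in> young_diagram la"
  shows "\<exists>x. x \<notin> beta_set la \<and> hook_length la (i, j) + x = beta_list la ! i"
proof -
  define m where "m = (LEAST m. i < m \<and> (m < length la \<longrightarrow> la ! m \<le> j))"
  have ij': "i < length la" "j < la ! i" using ij by (auto simp: young_diagram_def)
  then have m: "i < m" "m < length la \<longrightarrow> la ! m \<le> j"
    using LeastI[of "\<lambda>m. i < m \<and> (m < length la \<longrightarrow> la ! m \<le> j)" "length la"]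
    unfolding m_def by auto
  have "m \<le> length la"
    unfolding m_def using ij' by (intro Least_le) auto
  moreover have "j < la ! (m - 1)"
  proof (cases "m - 1 = i")
    case False
    then have "\<not> (i < m - 1 \<and> (m - 1 < length la \<longrightarrow> la ! (m - 1) \<le> j))"
      using not_less_Least[of "m - 1" "\<lambda>m. i < m \<and> (m < length la \<longrightarrow> la ! m \<le> j)"] m(1)
      unfolding m_def[symmetric] by auto
    then show ?thesis using False m(1) by auto
  qed (use ij' in simp)
  ultimately show ?thesis using hook_length_leg[OF la m(1)] m(2) by blast
qed

lemma ex_hook_of_gap:
  assumes la: "is_partition la" and i: "i < length la"
    and x: "x < beta_list la ! i" "x \<notin> beta_set la"
  shows "\<exists>j. (i, j) \<in> young_diagram la \<and> hook_length la (i, j) + x = beta_list la ! i"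
proof -
  \<comment> \<open>\<open>m\<close> is the first row below \<open>i\<close> whose bead lies below
    the gap \<open>x\<close>; the column is then recovered as
    \<open>x + m - length la\<close>.\<close>
  define m where "m = (LEAST m. i < m \<and> (m < length la \<longrightarrow> beta_list la ! m < x))"
  have m: "i < m" "m < length la \<longrightarrow> beta_list la ! m < x"
    using LeastI[of "\<lambda>m. i < m \<and> (m < length la \<longrightarrow> beta_list la ! m < x)" "length la"] i
    unfolding m_def by auto
  have m_le: "m \<le> length la"
    unfolding m_def using i by (intro Least_le) auto
  have "x \<le> beta_list la ! (m - 1)"
  proof (cases "m - 1 = i")
    case False
    then have "\<not> (i < m - 1 \<and> (m - 1 < length la \<longrightarrow> beta_list la ! (m - 1) < x))"
      using not_less_Least[of "m - 1" "\<lambda>m. i < m \<and> (m < length la \<longrightarrow> beta_list la ! m < x)"] m(1)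
      unfolding m_def[symmetric] by auto
    then show ?thesis using False m(1) by auto
  qed (use x in simp)
  moreover have "beta_list la ! (m - 1) \<in> beta_set la"
    using m(1) m_le la by (auto simp: beta_set_conv)
  ultimately have "x < beta_list la ! (m - 1)" using x(2) by (metis le_neq_implies_less)
  then have top: "x + m < la ! (m - 1) + length la"
    using m(1) m_le by (simp add: nth_beta_list)
  have bot: "length la \<le> x + m \<and> (m < length la \<longrightarrow> la ! m + length la \<le> x + m)"
    using m m_le partition_nth_pos[OF la, of m] by (cases "m < length la") (auto simp: nth_beta_list)
  define j where "j = x + m - length la"
  have x_eq: "length la - m + j = x" using bot m_le by (simp add: j_def)
  have leg: "j < la ! (m - 1)" unfolding j_def using top bot by linarith
  have "hook_length la (i, j) + (length la - m + j) = beta_list la ! i"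
  proof (rule hook_length_leg(1)[OF la m(1) m_le leg])
    show "la ! m \<le> j" if "m < length la" unfolding j_def using bot that by linarith
  qed
  moreover have "(i, j) \<in> young_diagram la"
  proof -
    have "i \<le> m - 1" "m - 1 < length la" using m(1) m_le by auto
    then have "j < la ! i" using leg partition_nth_antimono[OF la] less_le_trans by blast
    then show ?thesis using i by (simp add: young_diagram_def)
  qed
  ultimately show ?thesis unfolding x_eq by blast
qed

text \<open>A gap at \<open>h - t\<close> yields a hook of length exactly \<open>t\<close>.
  Conversely, a hook of length \<open>t * q\<close> joins a bead to a gap, while repeated
  subtraction of \<open>t\<close> would make that gap a bead.\<close>

lemma is_core_iff_beta_set:
  assumes la: "is_partition la" and t: "0 < t"
  shows "is_core t la \<longleftrightarrow> (\<forall>h\<in>beta_set la. t \<le> h \<longrightarrow> h - t \<in> beta_set la)"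
proof (intro iffI ballI impI)
  fix h assume core: "is_core t la" and h: "h \<in> beta_set la" "t \<le> h"
  then obtain i where i: "i < length la" "h = beta_list la ! i"
    using la by (auto simp: beta_set_conv)
  show "h - t \<in> beta_set la"
  proof (rule ccontr)
    assume "h - t \<notin> beta_set la"
    then obtain j where j: "(i, j) \<in> young_diagram la" "hook_length la (i, j) + (h - t) = h"
      using ex_hook_of_gap[OF la i(1), of "h - t"] i(2) h(2) t by auto
    then have "hook_length la (i, j) = t" using h(2) by simp
    then show False using core j(1) by (auto simp: is_core_def)
  qed
next
  assume down: "\<forall>h\<in>beta_set la. t \<le> h \<longrightarrow> h - t \<in> beta_set la"
  have multiple: "x \<in> beta_set la" if "x + t * q \<in> beta_set la" for x q
    using that
  proof (induction q)
    case (Suc q)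
    then have "(x + t * q) + t \<in> beta_set la" by (simp add: algebra_simps)
    then have "(x + t * q) + t - t \<in> beta_set la" using down le_add2 by blast
    then show ?case using Suc.IH by simp
  qed simp
  show "is_core t la"
    unfolding is_core_def
  proof (clarify)
    fix i j assume ij: "(i, j) \<in> young_diagram la" and dvd: "t dvd hook_length la (i, j)"
    from ij obtain x where x: "x \<notin> beta_set la" "hook_length la (i, j) + x = beta_list la ! i"
      using ex_gap_of_hook[OF la] by blast
    obtain q where "hook_length la (i, j) = t * q" using dvd by blast
    moreover have "beta_list la ! i \<in> beta_set la"
      using ij la by (auto simp: beta_set_conv young_diagram_def)
    ultimately show False using x multiple[of x q] by (metis add.commute)
  qed
qed

text \<open>Beads of adjacent rows differ by one more than their parts do, so equal parts correspond
  to consecutive beads.\<close>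

lemma distinct_iff_beta_set:
  assumes la: "is_partition la"
  shows "distinct la \<longleftrightarrow> (\<forall>h\<in>beta_set la. Suc h \<notin> beta_set la)"
proof (intro iffI ballI notI)
  fix h assume dist: "distinct la" and h: "h \<in> beta_set la" "Suc h \<in> beta_set la"
  then obtain a b where ab: "a < length la" "h = beta_list la ! a"
      "b < length la" "Suc h = beta_list la ! b"
    using la by (auto simp: beta_set_conv)
  have "b < a"
    using beta_list_nth_le_iff[OF la ab(3,1)] ab by simp
  then have "la ! a \<le> la ! b" using partition_nth_antimono[OF la, of b a] ab by simp
  then have "la ! a = la ! b" using ab \<open>b < a\<close> by (simp add: nth_beta_list)
  then show False using dist ab \<open>b < a\<close> by (simp add: nth_eq_iff_index_eq)
next
  assume sparse: "\<forall>h\<in>beta_set la. Suc h \<notin> beta_set la"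
  have "la ! b < la ! a" if "a < b" "b < length la" for a b
  proof -
    have "la ! b \<le> la ! Suc a" "la ! Suc a \<le> la ! a"
      using that by (intro partition_nth_antimono[OF la]; simp)+
    moreover have "la ! Suc a \<noteq> la ! a"
    proof
      assume "la ! Suc a = la ! a"
      then have "beta_list la ! a = Suc (beta_list la ! Suc a)"
        using that by (simp add: nth_beta_list)
      moreover have "beta_list la ! a \<in> beta_set la" "beta_list la ! Suc a \<in> beta_set la"
        using that la by (auto simp: beta_set_conv)
      ultimately show False using sparse by metis
    qed
    ultimately show ?thesis by simp
  qed
  then show "distinct la"
    unfolding distinct_conv_nth by (metis less_irrefl linorder_neqE_nat)
qed

lemma distinct_core_iff:
  assumes la: "is_partition la"
  shows "distinct_core (2 * k + 1) (2 * k + 3) la \<longleftrightarrow> twin_core_beads k (beta_set la)"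
proof -
  have "finite (beta_set la)" using la by (simp add: beta_set_eq)
  moreover have "0 \<notin> beta_set la"
  proof -
    have "beta_list la ! i \<noteq> 0" if "i < length la" for i
      using partition_nth_pos[OF la that] that by (simp add: nth_beta_list)
    then show ?thesis unfolding beta_set_conv[OF la] by (metis imageE lessThan_iff)
  qed
  ultimately show ?thesis
    using la by (auto simp: distinct_core_def twin_core_beads_def is_core_iff_beta_set
        distinct_iff_beta_set)
qed

section \<open>The \<open>\<beta>\<close>-set of \<open>mu k\<close> in staircase coordinates
  \<open>(j, u)\<close>\<close>

text \<open>Row \<open>j\<close> of the first family and the element \<open>p = j - 1\<close> of the second form one arithmetic
  progression of difference \<open>2\<close>, starting at \<open>j (2k + 3) - 1\<close>.\<close>

lemma mu_beta_eq:
  assumes "1 \<le> k"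
  shows "mu_beta k = {j * (2 * k + 3) + 2 * u - 1 |j u. j \<le> k \<and> u \<le> k - j \<and> 0 < j + u}"
    (is "_ = ?R")
proof (intro set_eqI iffI)
  fix x assume "x \<in> mu_beta k"
  then consider s i where "1 \<le> s" "s \<le> k" "1 \<le> i" "i \<le> k + 1 - s"
      "x = 2 * i - 1 + (s - 1) * (2 * k + 3)"
    | p where "p \<le> k - 1" "x = 2 * k + 2 + p * (2 * k + 3)"
    unfolding mu_beta_def by blast
  then show "x \<in> ?R"
  proof cases
    case 1
    then show ?thesis by (intro CollectI exI[of _ "s - 1"] exI[of _ i]) auto
  next
    case 2
    then show ?thesis using assms by (intro CollectI exI[of _ "p + 1"] exI[of _ 0]) auto
  qed
next
  fix x assume "x \<in> ?R"
  then obtain j u where ju: "j \<le> k" "u \<le> k - j" "0 < j + u" "x = j * (2 * k + 3) + 2 * u - 1"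
    by blast
  show "x \<in> mu_beta k"
  proof (cases "u = 0")
    case True
    then have "j - 1 \<le> k - 1" "x = 2 * k + 2 + (j - 1) * (2 * k + 3)"
      using ju by (cases j; simp)+
    then show ?thesis unfolding mu_beta_def by blast
  next
    case False
    then have "1 \<le> j + 1 \<and> j + 1 \<le> k \<and> 1 \<le> u \<and> u \<le> k + 1 - (j + 1)"
      and "x = 2 * u - 1 + (j + 1 - 1) * (2 * k + 3)" using ju by auto
    then show ?thesis unfolding mu_beta_def by blast
  qed
qed

text \<open>Subtracting \<open>2 * k + 3\<close> lowers \<open>j\<close>; subtracting
  \<open>2 * k + 1\<close> lowers \<open>j\<close> and raises \<open>u\<close>. Working with
  \<open>Suc h\<close> avoids truncated subtraction.\<close>

lemma twin_core_beads_mu_beta: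
  assumes "1 \<le> k"
  shows "twin_core_beads k (mu_beta k)"
proof
  show "finite (mu_beta k)"
  proof (rule finite_subset)
    show "mu_beta k \<subseteq> (\<lambda>(j, u). j * (2 * k + 3) + 2 * u - 1) ` ({..k} \<times> {..k})"
      unfolding mu_beta_eq[OF assms] by force
  qed simp
  have Suc_eq: "h = j * (2 * k + 3) + 2 * u - 1 \<longleftrightarrow> Suc h = j * (2 * k + 3) + 2 * u"
    if "0 < j + u" for h j u
    using that by (cases j; cases u) auto
  have memI: "h \<in> mu_beta k"
    if "j \<le> k" "u \<le> k - j" "0 < j + u" "Suc h = j * (2 * k + 3) + 2 * u" for h j u
    unfolding mu_beta_eq[OF assms] using that Suc_eq[OF that(3), of h] by blast
  have memE: "\<exists>j u. j \<le> k \<and> u \<le> k - j \<and> 0 < j + u \<and> Suc h = j * (2 * k + 3) + 2 * u"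
    if h: "h \<in> mu_beta k" for h
  proof -
    obtain j u where "j \<le> k" "u \<le> k - j" "0 < j + u" "h = j * (2 * k + 3) + 2 * u - 1"
      using h unfolding mu_beta_eq[OF assms] by blast
    then show ?thesis using Suc_eq[of j u h] by blast
  qed
  show "0 \<notin> mu_beta k"
  proof
    assume "0 \<in> mu_beta k"
    then obtain j u where "Suc 0 = j * (2 * k + 3) + 2 * u" using memE by blast
    then show False by (cases j) auto
  qed
  fix h assume "h \<in> mu_beta k"
  then obtain j u where ju: "j \<le> k" "u \<le> k - j" "0 < j + u" "Suc h = j * (2 * k + 3) + 2 * u"
    using memE by blast
  show "h - (2 * k + 3) \<in> mu_beta k" if le: "2 * k + 3 \<le> h"
  proof -
    obtain j' where j': "j = Suc j'" using ju le by (cases j) auto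
    moreover from this have "0 < j' + u" using ju(3,4) le by (cases j') auto
    ultimately show ?thesis using ju le by (intro memI[of j' u]) auto
  qed
  show "h - (2 * k + 1) \<in> mu_beta k" if le: "2 * k + 1 \<le> h"
  proof -
    obtain j' where j': "j = Suc j'" using ju le by (cases j) auto
    then show ?thesis using ju le by (intro memI[of j' "Suc u"]) auto
  qed
  show "Suc h \<notin> mu_beta k"
  proof
    assume "Suc h \<in> mu_beta k"
    then obtain j' u' where ju': "j' \<le> k" "u' \<le> k - j'" "Suc (Suc h) = j' * (2 * k + 3) + 2 * u'"
      using memE by blast
    \<comment> \<open>Consecutive elements would give one residue modulo \<open>2 * k + 3\<close>
      that is both odd and even.\<close>
    have "Suc (Suc h) = j * (2 * k + 3) + (2 * u + 1)" using ju(4) by simp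
    then have "Suc (Suc h) mod (2 * k + 3) = 2 * u + 1" using ju(2) by (simp only:) simp
    moreover have "Suc (Suc h) mod (2 * k + 3) = 2 * u'" using ju'(2,3) by (simp only:) simp
    ultimately have "2 * u + 1 = 2 * u'" by (simp only:)
    then show False by presburger
  qed
qed

lemma staircase_le_iff:
  fixes j u j' u' k :: nat
  assumes "u \<le> k" "u' \<le> k"
  shows "j * (2 * k + 3) + 2 * u \<le> j' * (2 * k + 3) + 2 * u' \<longleftrightarrow> j < j' \<or> j = j' \<and> u \<le> u'"
proof (cases j j' rule: linorder_cases)
  case less
  then have "Suc j * (2 * k + 3) \<le> j' * (2 * k + 3)" by (intro mult_le_mono1) simp
  then show ?thesis using less assms by simp
next
  case greater
  then have "Suc j' * (2 * k + 3) \<le> j * (2 * k + 3)" by (intro mult_le_mono1) simp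
  then show ?thesis using greater assms by simp
qed simp

lemma sum_staircase: "j \<le> k \<Longrightarrow> 2 * (\<Sum>i\<in>{Suc j..k}. Suc (k - i)) = (k - j) * (k - j + 1)"
proof (induction "k - j" arbitrary: j)
  case (Suc d)
  then have "{Suc j..k} = insert (Suc j) {Suc (Suc j)..k}" and d: "k - Suc j = d" by auto
  then have "(\<Sum>i\<in>{Suc j..k}. Suc (k - i)) = Suc d + (\<Sum>i\<in>{Suc (Suc j)..k}. Suc (k - i))"
    by simp
  moreover have "2 * (\<Sum>i\<in>{Suc (Suc j)..k}. Suc (k - i)) = d * (d + 1)"
    using Suc.hyps(1)[of "Suc j"] Suc.hyps(2) unfolding d by simp
  ultimately show ?case unfolding Suc.hyps(2)[symmetric] by simp
qed simp

text \<open>The elements are ordered lexicographically by \<open>(j, u)\<close>, so those counted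
  are all rows after \<open>j\<close>, namely \<open>?S\<close>, and the tail \<open>?T\<close> of
  row \<open>j\<close>.\<close>

lemma card_mu_beta_from:
  assumes "1 \<le> k" "j \<le> k" "u \<le> k - j" "0 < j + u"
  shows "2 * card (mu_beta k \<inter> {j * (2 * k + 3) + 2 * u - 1..})
    = (k - j) * (k - j + 1) + 2 * (k - j - u + 1)"
proof -
  let ?g = "\<lambda>(j, u). j * (2 * k + 3) + 2 * u - 1"
  let ?S = "Sigma {Suc j..k} (\<lambda>i. {..k - i})" and ?T = "{j} \<times> {u..k - j}"
  have le: "?g (j, u) \<le> ?g (j', u') \<longleftrightarrow> j < j' \<or> j = j' \<and> u \<le> u'"
    if "j' \<le> k" "u' \<le> k - j'" "0 < j' + u'" for j' u'
  proof -
    have "1 \<le> j * (2 * k + 3) + 2 * u" "1 \<le> j' * (2 * k + 3) + 2 * u'"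
      using that(3) assms(4) by (cases j; cases j'; simp)+
    then have "?g (j, u) \<le> ?g (j', u') \<longleftrightarrow> j * (2 * k + 3) + 2 * u \<le> j' * (2 * k + 3) + 2 * u'"
      unfolding prod.case by (rule le_diff_iff)
    then show ?thesis using staircase_le_iff[of u k u' j j'] that assms by simp
  qed
  have "mu_beta k \<inter> {?g (j, u)..} = ?g ` (?S \<union> ?T)"
  proof (intro set_eqI iffI)
    fix x assume "x \<in> mu_beta k \<inter> {?g (j, u)..}"
    then obtain j' u' where *: "j' \<le> k" "u' \<le> k - j'" "0 < j' + u'" "x = ?g (j', u')"
        "?g (j, u) \<le> x"
      unfolding mu_beta_eq[OF assms(1)] by auto
    then have "(j', u') \<in> ?S \<union> ?T" using le[OF *(1-3)] by auto
    then show "x \<in> ?g ` (?S \<union> ?T)" using *(4) by (rule rev_image_eqI)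
  next
    fix x assume "x \<in> ?g ` (?S \<union> ?T)"
    then obtain p where "p \<in> ?S \<union> ?T" "x = ?g p" by (rule imageE)
    then obtain j' u' where *: "(j', u') \<in> ?S \<union> ?T" "x = ?g (j', u')" by (cases p) blast
    then have "j' \<le> k" "u' \<le> k - j'" "0 < j' + u'" "j < j' \<or> j = j' \<and> u \<le> u'"
      using assms by auto
    then show "x \<in> mu_beta k \<inter> {?g (j, u)..}"
      using le[of j' u'] *(2) unfolding mu_beta_eq[OF assms(1)] by auto
  qed
  moreover have "inj_on ?g (?S \<union> ?T)"
  proof (rule inj_onI)
    fix p p' assume p: "p \<in> ?S \<union> ?T" "p' \<in> ?S \<union> ?T" "?g p = ?g p'"
    obtain a b a' b' where ab: "p = (a, b)" "p' = (a', b')" by (metis surj_pair)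
    then have "0 < a + b" "0 < a' + b'" using p(1,2) assms(4) by auto
    then have "1 \<le> a * (2 * k + 3) + 2 * b" "1 \<le> a' * (2 * k + 3) + 2 * b'"
      by (cases a; cases a'; simp)+
    then have "a * (2 * k + 3) + 2 * b = a' * (2 * k + 3) + 2 * b'"
      using p(3) eq_diff_iff unfolding ab prod.case by blast
    moreover have "b \<le> k" "b' \<le> k" using p ab by auto
    ultimately show "p = p'"
      using staircase_le_iff[of b k b' a a'] staircase_le_iff[of b' k b a' a] ab by auto
  qed
  ultimately have "card (mu_beta k \<inter> {?g (j, u)..}) = card (?S \<union> ?T)"
    by (simp only: card_image)
  also have "\<dots> = card ?S + card ?T" by (rule card_Un_disjoint) auto
  also have "\<dots> = (\<Sum>i\<in>{Suc j..k}. Suc (k - i)) + (k - j - u + 1)"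
    using assms by (simp add: Suc_diff_le)
  finally show ?thesis using sum_staircase[OF assms(2)] by simp
qed

section \<open>Comparison with \<open>mu k\<close>, part by part\<close>

text \<open>In the equality case, positivity of \<open>ys\<close> excludes surplus entries beyond
  \<open>xs\<close>.\<close>

lemma dominated_list_eq:
  fixes xs ys :: "nat list"
  assumes "length xs \<le> length ys" "\<And>i. i < length xs \<Longrightarrow> xs ! i \<le> ys ! i"
    and "\<And>y. y \<in> set ys \<Longrightarrow> 0 < y"
  shows "sum_list xs \<le> sum_list ys \<and> (sum_list ys \<le> sum_list xs \<longrightarrow> xs = ys)"
  using assms
proof (induction xs arbitrary: ys)
  case Nil
  then show ?case by (cases ys) auto
next
  case (Cons x xs)
  then obtain y zs where ys: "ys = y # zs" by (cases ys) auto
  have "x \<le> y" using Cons.prems(2)[of 0] ys by simp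
  moreover have "sum_list xs \<le> sum_list zs \<and> (sum_list zs \<le> sum_list xs \<longrightarrow> xs = zs)"
  proof (rule Cons.IH)
    show "xs ! i \<le> zs ! i" if "i < length xs" for i
      using Cons.prems(2)[of "Suc i"] that ys by simp
  qed (use Cons.prems ys in auto)
  ultimately show ?case unfolding ys by auto
qed

theorem theorem6:
  fixes k :: nat and la :: "nat list"
  assumes "k \<ge> 1"
    and "distinct_core (2*k + 1) (2*k + 3) la"
    and "\<And>nu. distinct_core (2*k + 1) (2*k + 3) nu \<Longrightarrow> sum_list nu \<le> sum_list la"
  shows "la = mu k"
proof -
  have la: "is_partition la" using assms(2) by (simp add: distinct_core_def)
  have "is_partition (mu k) \<and> beta_set (mu k) = mu_beta k"
    unfolding mu_def by (rule theI'[OF ex1_mu])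
  then have mu: "is_partition (mu k)" "beta_set (mu k) = mu_beta k" by auto
  interpret twin_core_beads k "beta_set la"
    using assms(2) unfolding distinct_core_iff[OF la] .
  have core_mu: "distinct_core (2 * k + 1) (2 * k + 3) (mu k)"
    using distinct_core_iff[OF mu(1)] twin_core_beads_mu_beta[OF assms(1)] mu(2) by simp
  \<comment> \<open>The least bead \<open>1\<close> has coordinates \<open>(0, 1)\<close>, so
    counting from it gives the whole cardinality.\<close>
  have "mu_beta k \<inter> {1..} = mu_beta k"
    using twin_core_beads.zero[OF twin_core_beads_mu_beta[OF assms(1)]]
    by (auto simp: Suc_le_eq intro: gr0I)
  then have len_mu: "2 * length (mu k) = k * (k + 3)"
    using card_mu_beta_from[of k 0 1] assms(1) card_beta_set[OF mu(1)] mu(2)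
    by (simp add: algebra_simps)
  have len: "length la \<le> length (mu k)"
    using card_H_le card_beta_set[OF la] len_mu by simp
  have "la ! i \<le> mu k ! i" if i: "i < length la" for i
  proof -
    have i': "i < length (mu k)" using i len by simp
    then have "beta_list (mu k) ! i \<in> mu_beta k" using mu by (auto simp: beta_set_conv)
    then obtain j u where ju: "j \<le> k" "u \<le> k - j" "0 < j + u"
        "beta_list (mu k) ! i = j * (2 * k + 3) + 2 * u - 1"
      unfolding mu_beta_eq[OF assms(1)] by blast
    \<comment> \<open>Row index \<open>i\<close> means rank \<open>Suc i\<close> in both
      \<open>\<beta>\<close>-sets, so the count for \<open>mu k\<close> transfers to
      \<open>la\<close>.\<close>
    have N: "2 * Suc i = (k - j) * (k - j + 1) + 2 * (k - j - u + 1)"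
      using card_mu_beta_from[OF assms(1) ju(1-3)] card_beta_set_from[OF mu(1) i'] mu(2) ju(4)
      by simp
    have "beta_list la ! i \<in> beta_set la" using la i by (auto simp: beta_set_conv)
    then have "2 * beta_list la ! i \<le> 2 * (length la - 1 - i) + 2 * u + j * (2 * k + 3 + j)"
      using gaps_below_le[OF _ ju(1,2)] N card_beta_set_from[OF la i] card_beta_set_below[OF la i]
      by metis
    then have la_i: "2 * la ! i \<le> 2 * u + j * (2 * k + 3 + j)"
      using i by (simp add: nth_beta_list)
    obtain w where w: "k = j + u + w"
      using ju(1,2) by (metis le_add_diff_inverse add.assoc)
    \<comment> \<open>Solving for the part shows that \<open>mu k\<close> attains the bound
      \<open>la_i\<close>.\<close>
    have "mu k ! i + length (mu k) = beta_list (mu k) ! i + Suc i"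
      using i' by (simp add: nth_beta_list)
    then have "2 * mu k ! i + k * (k + 3) + 2 = 2 * (j * (2 * k + 3) + 2 * u) + 2 * Suc i"
      using ju(3,4) len_mu by (cases j) auto
    then have "2 * mu k ! i = 2 * u + j * (2 * k + 3 + j)"
      unfolding N w by (simp add: algebra_simps)
    then show ?thesis using la_i by simp
  qed
  then show ?thesis
    using dominated_list_eq[OF len] assms(3)[OF core_mu] mu(1) by (simp add: is_partition_def)
qed

end
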